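(* For all integers $n>1$ and $t>1$ there are bijections between any two of the sets $\mathcal{CGVSV}(n,t)$, $\mathcal{CGPSP}(n,t)$, $\mathcal{CGVN}(n,t)$ and $\mathcal{CGPN}(n,t)$.
   Context: A simple game is a pair $(N,W)$ with $N=\{1,\dots,n\}$ and $W$ a family of subsets of $N$ (the winning coalitions) such that $N\in W$, $\emptyset\notin W$, and $S\in W$, $S\subseteq T\subseteq N$ imply $T\in W$. $W^m$ denotes the set of inclusion-minimal winning coalitions. Players $i,j$ are equally desirable ($i\approx j$) if $S\cup\{i\}\in W\iff S\cup\{j\}\in W$ for all $S\subseteq N\setminus\{i,j\}$; $i\succsim j$ if $S\cup\{j\}\in W\Rightarrow S\cup\{i\}\in W$ for all $S\subseteq N\setminus\{i,j\}$. The game is complete if $\succsim$ is a complete preorder. The number of types $t$ is the number of equivalence classes of $\approx$. Player $i$: has veto if $i\in S$ for all $S\in W$; is a passer if $\{i\}\in W$; is null if $i\notin S$ for all $S\in W^m$; has semi-veto if $N\setminus\{i\}\in W$ and $i\in S$ for every $S\in W$ other than $N\setminus\{i\}$; is a semi-passer if $\{i\}\notin W$ and $\{i,j\}\in W$ for all $j\ne i$. $\mathcal{CGVSV}(n,t)$, $\mathcal{CGPSP}(n,t)$, $\mathcal{CGVN}(n,t)$, $\mathcal{CGPN}(n,t)$ denote the sets of isomorphism classes (isomorphism = bijection of players preserving winning coalitions) of complete simple games with $n$ players and exactly $t$ types containing, respectively, at least one vetoer and at least one semi-vetoer; at least one passer and at least one semi-passer; at least one vetoer and at least one null player; at least one passer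 and at least one null player. *)

theory Defs
  imports Main
begin

definition simple_game :: "'a set \<Rightarrow> 'a set set \<Rightarrow> bool" where
  "simple_game N W \<longleftrightarrow>
     W \<subseteq> Pow N \<and> N \<in> W \<and> {} \<notin> W \<and>
     (\<forall>S T. S \<in> W \<longrightarrow> S \<subseteq> T \<longrightarrow> T \<subseteq> N \<longrightarrow> T \<in> W)"

definition minimal_winning :: "'a set set \<Rightarrow> 'a set set" where
  "minimal_winning W = {S \<in> W. \<forall>T \<in> W. T \<subseteq> S \<longrightarrow> T = S}"

text \<open>A pair \<open>(i, j)\<close> belongs to this relation iff \<open>i\<close> is at least as desirable as \<open>j\<close>.\<close>

definition desirability :: "'a set \<Rightarrow> 'a set set \<Rightarrow> ('a \<times> 'a) set" where
  "desirability N W =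
     {(i, j). i \<in> N \<and> j \<in> N \<and>
        (\<forall>S. S \<subseteq> N - {i, j} \<longrightarrow> S \<union> {j} \<in> W \<longrightarrow> S \<union> {i} \<in> W)}"

definition equally_desirable :: "'a set \<Rightarrow> 'a set set \<Rightarrow> ('a \<times> 'a) set" where
  "equally_desirable N W =
     {(i, j). i \<in> N \<and> j \<in> N \<and>
        (\<forall>S. S \<subseteq> N - {i, j} \<longrightarrow> (S \<union> {i} \<in> W \<longleftrightarrow> S \<union> {j} \<in> W))}"

definition complete_game :: "'a set \<Rightarrow> 'a set set \<Rightarrow> bool" where
  "complete_game N W \<longleftrightarrow>
     simple_game N W \<and> preorder_on N (desirability N W) \<and> total_on N (desirability N W)"

definition num_types :: "'a set \<Rightarrow> 'a set set \<Rightarrow> nat" where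
  "num_types N W = card (N // equally_desirable N W)"

definition vetoer :: "'a set set \<Rightarrow> 'a \<Rightarrow> bool" where
  "vetoer W i \<longleftrightarrow> (\<forall>S \<in> W. i \<in> S)"

definition passer :: "'a set set \<Rightarrow> 'a \<Rightarrow> bool" where
  "passer W i \<longleftrightarrow> {i} \<in> W"

definition null_player :: "'a set set \<Rightarrow> 'a \<Rightarrow> bool" where
  "null_player W i \<longleftrightarrow> (\<forall>S \<in> minimal_winning W. i \<notin> S)"

definition semi_vetoer :: "'a set \<Rightarrow> 'a set set \<Rightarrow> 'a \<Rightarrow> bool" where
  "semi_vetoer N W i \<longleftrightarrow> N - {i} \<in> W \<and> (\<forall>S \<in> W. S \<noteq> N - {i} \<longrightarrow> i \<in> S)"

definition semi_passer :: "'a set \<Rightarrow> 'a set set \<Rightarrow> 'a \<Rightarrow> bool" where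
  "semi_passer N W i \<longleftrightarrow> {i} \<notin> W \<and> (\<forall>j \<in> N. j \<noteq> i \<longrightarrow> {i, j} \<in> W)"

definition game_iso :: "'a set \<Rightarrow> ('a set set \<times> 'a set set) set" where
  "game_iso N =
     {(W, W'). simple_game N W \<and> simple_game N W' \<and>
        (\<exists>\<pi>. bij_betw \<pi> N N \<and> (\<forall>S. S \<subseteq> N \<longrightarrow> (S \<in> W \<longleftrightarrow> \<pi> ` S \<in> W')))}"

definition CG :: "nat \<Rightarrow> nat \<Rightarrow> nat set set set" where
  "CG n t = {W. complete_game {1..n} W \<and> num_types {1..n} W = t}"

definition CGVSV :: "nat \<Rightarrow> nat \<Rightarrow> nat set set set set" where
  "CGVSV n t =
     {W \<in> CG n t. (\<exists>i \<in> {1..n}. vetoer W i) \<and> (\<exists>i \<in> {1..n}. semi_vetoer {1..n} W i)}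
       // game_iso {1..n}"

definition CGPSP :: "nat \<Rightarrow> nat \<Rightarrow> nat set set set set" where
  "CGPSP n t =
     {W \<in> CG n t. (\<exists>i \<in> {1..n}. passer W i) \<and> (\<exists>i \<in> {1..n}. semi_passer {1..n} W i)}
       // game_iso {1..n}"

definition CGVN :: "nat \<Rightarrow> nat \<Rightarrow> nat set set set set" where
  "CGVN n t =
     {W \<in> CG n t. (\<exists>i \<in> {1..n}. vetoer W i) \<and> (\<exists>i \<in> {1..n}. null_player W i)}
       // game_iso {1..n}"

definition CGPN :: "nat \<Rightarrow> nat \<Rightarrow> nat set set set set" where
  "CGPN n t =
     {W \<in> CG n t. (\<exists>i \<in> {1..n}. passer W i) \<and> (\<exists>i \<in> {1..n}. null_player W i)}
       // game_iso {1..n}"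

end

theory Submission
  imports Defs "HOL-Combinatorics.Transposition"
begin

text \<open>Passing to the dual game (complements of losing coalitions) exchanges vetoers with passers
  and semi-vetoers with semi-passers and keeps null players, desirability and types. Hence only the
  games with a vetoer and a null player have to be compared with the games with a vetoer and a
  semi-vetoer. Both kinds with \<open>n + 1\<close> players arise, uniquely up to isomorphism, from an arbitrary
  complete game \<open>U\<close> with a vetoer on \<open>n\<close> players by adding a player that is null, respectively a
  semi-vetoer. The added player forms a new type unless \<open>U\<close> has such a player already. So both
  counts \<open>x\<close> satisfy \<open>x (n + 1) (t + 1) = x n (t + 1) + (v n t - x n t)\<close>, where \<open>v\<close> counts the
  complete games with a vetoer, and they agree by induction on \<open>n\<close>.\<close>

section \<open>Counting classes\<close>

text \<open>\<open>A // r\<close> consists of full classes in \<open>X\<close> that meet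
  \<open>A\<close>. Hypothesis \<open>rel\<close> makes \<open>f\<close> induce a well-defined and
  injective map on them, which is onto as soon as every \<open>b\<close> is equivalent to some
  \<open>f a\<close>.\<close>

lemma card_quotient_eq:
  assumes r: "equiv X r" and s: "equiv Y s" and "A \<subseteq> X" "B \<subseteq> Y"
    and f: "\<And>x. x \<in> A \<Longrightarrow> f x \<in> B"
    and rel: "\<And>x y. x \<in> A \<Longrightarrow> y \<in> A \<Longrightarrow> (x, y) \<in> r \<longleftrightarrow> (f x, f y) \<in> s"
    and surj: "\<And>b. b \<in> B \<Longrightarrow> \<exists>a \<in> A. (f a, b) \<in> s"
  shows "card (A // r) = card (B // s)"
proof (rule bij_betw_same_card)
  \<comment> \<open>A class may leave \<open>A\<close>, where nothing is known about
    \<open>f\<close>; hence the choice of a representative in \<open>A\<close>.\<close>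
  let ?g = "\<lambda>c. s `` {f (SOME x. x \<in> A \<and> c = r `` {x})}"
  have g: "?g (r `` {x}) = s `` {f x}" if "x \<in> A" for x
  proof -
    have "\<exists>y. y \<in> A \<and> r `` {x} = r `` {y}" using that by blast
    then have *: "(SOME y. y \<in> A \<and> r `` {x} = r `` {y}) \<in> A"
      "r `` {x} = r `` {SOME y. y \<in> A \<and> r `` {x} = r `` {y}}"
      using someI_ex[of "\<lambda>y. y \<in> A \<and> r `` {x} = r `` {y}"] by blast+
    with rel that have "(f x, f (SOME y. y \<in> A \<and> r `` {x} = r `` {y})) \<in> s"
      using eq_equiv_class[OF *(2) r] \<open>A \<subseteq> X\<close> by blast
    then show ?thesis using equiv_class_eq[OF s] by blast
  qed
  show "bij_betw ?g (A // r) (B // s)"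
  proof (rule bij_betw_imageI)
    show "inj_on ?g (A // r)"
    proof (rule inj_onI)
      fix c d assume "c \<in> A // r" "d \<in> A // r" and eq: "?g c = ?g d"
      then obtain x y where xy: "x \<in> A" "c = r `` {x}" "y \<in> A" "d = r `` {y}"
        by (auto elim!: quotientE)
      then have "s `` {f x} = s `` {f y}" using eq g by simp
      moreover have "f y \<in> Y" using f xy \<open>B \<subseteq> Y\<close> by blast
      ultimately have "(f x, f y) \<in> s" using eq_equiv_class s by metis
      then show "c = d" using rel xy equiv_class_eq[OF r] by blast
    qed
    show "?g ` (A // r) = B // s"
    proof
      show "?g ` (A // r) \<subseteq> B // s"
      proof (rule image_subsetI)
        fix c assume "c \<in> A // r"
        then obtain x where x: "x \<in> A" "c = r `` {x}" by (auto elim!: quotientE)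
        then have "?g c = s `` {f x}" using g by simp
        then show "?g c \<in> B // s" using f x quotientI by metis
      qed
      show "B // s \<subseteq> ?g ` (A // r)"
      proof
        fix c assume "c \<in> B // s"
        then obtain b where b: "b \<in> B" "c = s `` {b}" by (auto elim!: quotientE)
        then obtain a where a: "a \<in> A" "(f a, b) \<in> s" using surj by blast
        have "c = ?g (r `` {a})" unfolding g[OF a(1)] b(2) using equiv_class_eq[OF s a(2)] by simp
        then show "c \<in> ?g ` (A // r)" by (rule image_eqI) (rule quotientI[OF a(1)])
      qed
    qed
  qed
qed

lemma finite_quotientI: "finite A \<Longrightarrow> finite (A // r)"
  by (simp add: quotient_def)

text \<open>The separation hypothesis concerns classes: elements of disjoint \<open>A\<close> and
  \<open>B\<close> could still represent the same class.\<close>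

lemma card_quotient_Un:
  assumes r: "equiv X r" and "A \<subseteq> X" "B \<subseteq> X" "finite A" "finite B"
    and "\<And>x y. x \<in> A \<Longrightarrow> y \<in> B \<Longrightarrow> (x, y) \<notin> r"
  shows "card ((A \<union> B) // r) = card (A // r) + card (B // r)"
proof -
  have "A // r \<inter> B // r = {}"
  proof (rule ccontr)
    assume "A // r \<inter> B // r \<noteq> {}"
    then obtain x y where "x \<in> A" "y \<in> B" "r `` {x} = r `` {y}"
      by (auto simp: quotient_def)
    then show False using eq_equiv_class[OF _ r] assms by blast
  qed
  moreover have "(A \<union> B) // r = A // r \<union> B // r" by (auto simp: quotient_def)
  ultimately show ?thesis
    using assms by (simp add: card_Un_disjoint finite_quotientI)
qed

section \<open>Isomorphisms and desirability\<close>

lemma simple_gameD: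
  assumes "simple_game N W"
  shows "S \<in> W \<Longrightarrow> S \<subseteq> N" "N \<in> W" "{} \<notin> W"
    "S \<in> W \<Longrightarrow> S \<subseteq> T \<Longrightarrow> T \<subseteq> N \<Longrightarrow> T \<in> W"
  using assms unfolding simple_game_def by blast+

lemma finite_simple_games: "finite N \<Longrightarrow> finite {W. simple_game N W}"
  by (rule finite_subset[of _ "Pow (Pow N)"]) (auto simp: simple_game_def)

text \<open>Exposes the bijection hidden in \<open>game_iso\<close>, so that the images of single
  players can be followed.\<close>

definition iso_by :: "('a \<Rightarrow> 'a) \<Rightarrow> 'a set \<Rightarrow> 'a set set \<Rightarrow> 'a set set \<Rightarrow> bool" where
  "iso_by \<pi> N W W' \<longleftrightarrow> simple_game N W \<and> simple_game N W' \<and> bij_betw \<pi> N N \<and>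
     (\<forall>S. S \<subseteq> N \<longrightarrow> (S \<in> W \<longleftrightarrow> \<pi> ` S \<in> W'))"

lemma game_iso_iff: "(W, W') \<in> game_iso N \<longleftrightarrow> (\<exists>\<pi>. iso_by \<pi> N W W')"
  unfolding game_iso_def iso_by_def by blast

lemma iso_by_id: "simple_game N W \<Longrightarrow> iso_by id N W W"
  unfolding iso_by_def by simp

lemma iso_by_inv:
  assumes "iso_by \<pi> N W W'"
  shows "iso_by (inv_into N \<pi>) N W' W"
proof -
  have b: "bij_betw \<pi> N N" using assms unfolding iso_by_def by blast
  then have b': "bij_betw (inv_into N \<pi>) N N" by (rule bij_betw_inv_into)
  have "S \<in> W' \<longleftrightarrow> inv_into N \<pi> ` S \<in> W" if "S \<subseteq> N" for S
  proof -
    have "inv_into N \<pi> ` S \<subseteq> N" using b' that unfolding bij_betw_def by blast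
    moreover have "\<pi> ` inv_into N \<pi> ` S = S"
      using b that by (simp add: bij_betw_imp_surj_on image_inv_into_cancel)
    ultimately show ?thesis using assms unfolding iso_by_def by metis
  qed
  then show ?thesis using assms b' unfolding iso_by_def by blast
qed

lemma iso_by_comp:
  assumes "iso_by \<pi> N W W'" "iso_by \<sigma> N W' W''"
  shows "iso_by (\<sigma> \<circ> \<pi>) N W W''"
proof -
  have "S \<in> W \<longleftrightarrow> (\<sigma> \<circ> \<pi>) ` S \<in> W''" if "S \<subseteq> N" for S
  proof -
    have "\<pi> ` S \<subseteq> N" using assms(1) that unfolding iso_by_def bij_betw_def by blast
    then show ?thesis using assms that unfolding iso_by_def by (metis image_comp)
  qed
  then show ?thesis using assms unfolding iso_by_def by (metis bij_betw_trans)
qed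

lemma equiv_game_iso: "equiv {W. simple_game N W} (game_iso N)"
proof (rule equivI)
  show "game_iso N \<subseteq> {W. simple_game N W} \<times> {W. simple_game N W}"
    by (auto simp: game_iso_def)
  show "refl_on {W. simple_game N W} (game_iso N)"
    by (auto simp: refl_on_def game_iso_iff intro: iso_by_id)
  show "sym (game_iso N)"
    by (auto simp: sym_def game_iso_iff intro: iso_by_inv)
  show "trans (game_iso N)"
    by (auto simp: trans_def game_iso_iff intro: iso_by_comp)
qed

section \<open>The desirability preorder\<close>

lemma desirabilityI:
  assumes "i \<in> N" "j \<in> N"
    and "\<And>S. S \<subseteq> N \<Longrightarrow> i \<notin> S \<Longrightarrow> j \<notin> S \<Longrightarrow> insert j S \<in> W \<Longrightarrow> insert i S \<in> W"
  shows "(i, j) \<in> desirability N W"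
  using assms unfolding desirability_def by auto

lemma desirabilityD:
  assumes "(i, j) \<in> desirability N W"
  shows "i \<in> N" "j \<in> N"
    "S \<subseteq> N \<Longrightarrow> i \<notin> S \<Longrightarrow> j \<notin> S \<Longrightarrow> insert j S \<in> W \<Longrightarrow> insert i S \<in> W"
proof -
  show "i \<in> N" "j \<in> N" using assms unfolding desirability_def by auto
  assume "S \<subseteq> N" "i \<notin> S" "j \<notin> S" "insert j S \<in> W"
  moreover from this have "S \<subseteq> N - {i, j}" "S \<union> {j} \<in> W" by auto
  ultimately have "S \<union> {i} \<in> W" using assms unfolding desirability_def by blast
  then show "insert i S \<in> W" by simp
qed

text \<open>The relation is tested only on coalitions avoiding both players. If the middle player
  \<open>j\<close> lies outside \<open>S\<close>, the two hypotheses are applied to \<open>S\<close>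
  one after the other; if \<open>j\<close> lies in \<open>S\<close>, they are applied in the
  opposite order.\<close>

lemma desirability_trans: "trans (desirability N W)"
proof (rule transI)
  fix i j k assume ij: "(i, j) \<in> desirability N W" and jk: "(j, k) \<in> desirability N W"
  show "(i, k) \<in> desirability N W"
  proof (cases "i = j \<or> j = k \<or> i = k")
    case True
    then show ?thesis using ij jk by (auto intro: desirabilityI desirabilityD)
  next
    case False
    show ?thesis
    proof (rule desirabilityI)
      show "i \<in> N" "k \<in> N" using ij jk by (auto intro: desirabilityD)
    next
      fix S assume S: "S \<subseteq> N" "i \<notin> S" "k \<notin> S" "insert k S \<in> W"
      show "insert i S \<in> W"
      proof (cases "j \<in> S")
        case False
        then show ?thesis using S desirabilityD(3)[OF jk, of S] desirabilityD(3)[OF ij, of S] by blast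
      next
        case True
        \<comment> \<open>The route is \<open>R\<close> with \<open>j, k\<close>, then
          \<open>R\<close> with \<open>i, k\<close>, then \<open>R\<close> with
          \<open>i, j\<close>.\<close>
        define R where "R = S - {j}"
        then have S_eq: "S = insert j R" and R: "R \<subseteq> N" "i \<notin> R" "j \<notin> R" "k \<notin> R"
          using True S by auto
        have "insert j (insert k R) \<in> W" using S S_eq by (simp add: insert_commute)
        then have "insert i (insert k R) \<in> W"
          using desirabilityD(3)[OF ij, of "insert k R"] desirabilityD(2)[OF jk] R \<open>\<not> (i = j \<or> _)\<close> by blast
        then have "insert k (insert i R) \<in> W" by (simp add: insert_commute)
        then have "insert j (insert i R) \<in> W"
          using desirabilityD(3)[OF jk, of "insert i R"] desirabilityD(1)[OF ij] R \<open>\<not> (i = j \<or> _)\<close> by blast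
        then show ?thesis using S_eq by (simp add: insert_commute)
      qed
    qed
  qed
qed

lemma desirability_refl: "i \<in> N \<Longrightarrow> (i, i) \<in> desirability N W"
  by (rule desirabilityI)

text \<open>Desirability is reflexive and transitive for every family \<open>W\<close>, so
  completeness only asks that any two players be comparable.\<close>

lemma complete_game_iff:
  "complete_game N W \<longleftrightarrow> simple_game N W \<and>
     (\<forall>i \<in> N. \<forall>j \<in> N. (i, j) \<in> desirability N W \<or> (j, i) \<in> desirability N W)"
proof -
  have "preorder_on N (desirability N W)"
    unfolding preorder_on_def
    by (auto simp: refl_on_def desirability_trans desirability_refl intro: desirabilityD)
  then show ?thesis
    unfolding complete_game_def total_on_def using desirability_refl[of _ N W] by metis
qed

lemma equally_desirable_iff:
  "(i, j) \<in> equally_desirable N W \<longleftrightarrow>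
     (i, j) \<in> desirability N W \<and> (j, i) \<in> desirability N W"
  unfolding equally_desirable_def desirability_def by (auto simp: insert_commute)

lemma equiv_equally_desirable: "equiv N (equally_desirable N W)"
proof (rule equivI)
  show "trans (equally_desirable N W)"
    using desirability_trans[of N W] unfolding trans_def equally_desirable_iff by blast
qed (auto simp: equally_desirable_iff refl_on_def sym_def desirability_refl dest: desirabilityD)

section \<open>Transport along isomorphisms\<close>

lemma desirability_iso:
  assumes "iso_by \<pi> N W W'" "i \<in> N" "j \<in> N"
  shows "(i, j) \<in> desirability N W \<longleftrightarrow> (\<pi> i, \<pi> j) \<in> desirability N W'"
proof -
  \<comment> \<open>One direction for arbitrary isomorphisms; the other follows by applying it to
    the inverse.\<close>
  have *: "(i, j) \<in> desirability N W"
    if iso: "iso_by \<pi> N W W'" and ij: "i \<in> N" "j \<in> N"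
      and d: "(\<pi> i, \<pi> j) \<in> desirability N W'" for \<pi> W W' i j
  proof (rule desirabilityI)
    show "i \<in> N" "j \<in> N" by (rule ij)+
  next
    fix S assume S: "S \<subseteq> N" "i \<notin> S" "j \<notin> S" "insert j S \<in> W"
    have b: "bij_betw \<pi> N N" and W: "\<And>S. S \<subseteq> N \<Longrightarrow> S \<in> W \<longleftrightarrow> \<pi> ` S \<in> W'"
      using iso unfolding iso_by_def by blast+
    have "\<pi> ` S \<subseteq> N" "\<pi> i \<notin> \<pi> ` S" "\<pi> j \<notin> \<pi> ` S"
      using b S ij unfolding bij_betw_def inj_on_def by blast+
    moreover have "insert (\<pi> j) (\<pi> ` S) \<in> W'"
      using W[of "insert j S"] S ij by simp
    ultimately have "insert (\<pi> i) (\<pi> ` S) \<in> W'" using desirabilityD(3)[OF d] by blast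
    then show "insert i S \<in> W" using W[of "insert i S"] S ij by simp
  qed
  have b: "bij_betw \<pi> N N" using assms(1) unfolding iso_by_def by blast
  then have "inv_into N \<pi> (\<pi> i) = i" "inv_into N \<pi> (\<pi> j) = j"
    using assms by (simp_all add: bij_betw_def inv_into_f_f)
  moreover have "\<pi> i \<in> N" "\<pi> j \<in> N" using b assms unfolding bij_betw_def by blast+
  ultimately show ?thesis
    using *[OF assms] *[OF iso_by_inv[OF assms(1)], of "\<pi> i" "\<pi> j"] by auto
qed

lemma iso_by_onE:
  assumes "iso_by \<pi> N W W'" "j \<in> N"
  obtains i where "i \<in> N" "j = \<pi> i"
  using assms unfolding iso_by_def bij_betw_def by blast

lemma iso_by_in: "iso_by \<pi> N W W' \<Longrightarrow> i \<in> N \<Longrightarrow> \<pi> i \<in> N"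
  unfolding iso_by_def bij_betw_def by blast

lemma iso_by_setE:
  assumes "iso_by \<pi> N W W'" "S \<in> W'"
  obtains R where "R \<in> W" "R \<subseteq> N" "S = \<pi> ` R"
proof -
  have "S \<subseteq> N" "\<pi> ` N = N"
    using assms simple_gameD(1) by (auto simp: iso_by_def bij_betw_def)
  then obtain R where R: "R \<subseteq> N" "S = \<pi> ` R" by (metis subset_imageE)
  with assms have "R \<in> W" by (simp add: iso_by_def)
  then show thesis using that R by blast
qed

lemma iso_by_image_Diff:
  assumes "iso_by \<pi> N W W'" "R \<subseteq> N" "i \<in> N"
  shows "\<pi> ` (R - {i}) = \<pi> ` R - {\<pi> i}"
  using assms inj_on_image_set_diff[of \<pi> N R "{i}"] unfolding iso_by_def bij_betw_def by auto

lemma complete_game_iso: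
  assumes "iso_by \<pi> N W W'" "complete_game N W"
  shows "complete_game N W'"
proof -
  have "(i, j) \<in> desirability N W' \<or> (j, i) \<in> desirability N W'" if "i \<in> N" "j \<in> N" for i j
    using that assms desirability_iso[OF assms(1)] unfolding complete_game_iff
    by (metis iso_by_onE)
  then show ?thesis using assms unfolding complete_game_iff iso_by_def by blast
qed

lemma num_types_iso:
  assumes "iso_by \<pi> N W W'"
  shows "num_types N W = num_types N W'"
  unfolding num_types_def
proof (rule card_quotient_eq[where f = \<pi>, OF equiv_equally_desirable equiv_equally_desirable])
  fix i j assume "i \<in> N" "j \<in> N"
  then show "(i, j) \<in> equally_desirable N W \<longleftrightarrow> (\<pi> i, \<pi> j) \<in> equally_desirable N W'"
    using desirability_iso[OF assms] by (simp add: equally_desirable_iff)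
next
  fix j assume "j \<in> N"
  then obtain i where "i \<in> N" "\<pi> i = j" using iso_by_onE[OF assms] by metis
  then show "\<exists>i \<in> N. (\<pi> i, j) \<in> equally_desirable N W'"
    using \<open>j \<in> N\<close> by (intro bexI[of _ i]) (simp_all add: equally_desirable_iff desirability_refl)
qed (auto intro: iso_by_in[OF assms])

lemma vetoer_iso:
  assumes "iso_by \<pi> N W W'" "vetoer W i"
  shows "vetoer W' (\<pi> i)"
  unfolding vetoer_def using assms(2) by (auto simp: vetoer_def elim!: iso_by_setE[OF assms(1)])

text \<open>Coalitions containing both players or neither are fixed by the swap. For a coalition
  with exactly one of them, equal desirability says that the exchange keeps it winning. These
  automorphisms allow the added player to be moved back to its place.\<close>

lemma iso_by_transpose:
  assumes W: "simple_game N W" and ij: "(i, j) \<in> equally_desirable N W"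
  shows "iso_by (transpose i j) N W W"
proof -
  have N: "i \<in> N" "j \<in> N" using ij by (auto simp: equally_desirable_def)
  have 1: "transpose i j ` S \<in> W"
    if "(i, j) \<in> desirability N W" "S \<in> W" "i \<notin> S" "j \<in> S" for i j S
  proof -
    have "S = insert j (S - {j})" using that by blast
    moreover have "transpose i j ` (S - {j}) = S - {j}" using that by simp
    ultimately have "transpose i j ` S = insert i (S - {j})"
      by (metis image_insert transpose_apply_second)
    moreover have "insert i (S - {j}) \<in> W"
      using desirabilityD(3)[OF that(1), of "S - {j}"] that simple_gameD(1)[OF W]
      by (metis DiffD1 Diff_iff Diff_subset insertI1 insert_Diff subset_trans)
    ultimately show ?thesis by simp
  qed
  have 2: "transpose i j ` S \<in> W" if "S \<in> W" for S
  proof (cases "i \<in> S \<longleftrightarrow> j \<in> S")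
    case True
    then show ?thesis using that by simp
  next
    case False
    then show ?thesis
      using 1[of i j S] 1[of j i S] that ij
      by (auto simp: equally_desirable_iff transpose_commute[of j i])
  qed
  \<comment> \<open>The swap is an involution, so the forward implication applied to the image gives
    the converse.\<close>
  have "S \<in> W" if "transpose i j ` S \<in> W" for S
    using 2[OF that] by (simp add: image_comp)
  then show ?thesis using 2 W N unfolding iso_by_def by (metis bij_betw_transpose_iff)
qed

text \<open>Serves to rename players, so that a prescribed player takes the role of the added
  one.\<close>

lemma iso_by_image:
  assumes W: "simple_game N W" and b: "bij_betw \<pi> N N"
  shows "iso_by \<pi> N W ((`) \<pi> ` W)"
proof -
  have sub: "W \<subseteq> Pow N" using W by (auto simp: simple_game_def)
  have inj: "inj_on ((`) \<pi>) (Pow N)" and im: "\<pi> ` N = N"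
    using b by (auto simp: bij_betw_def inj_on_image_Pow)
  have mem: "\<pi> ` S \<in> (`) \<pi> ` W \<longleftrightarrow> S \<in> W" if "S \<subseteq> N" for S
    using inj_on_image_mem_iff[OF inj _ sub, of S] that by simp
  have "simple_game N ((`) \<pi> ` W)"
    unfolding simple_game_def
  proof (intro conjI allI impI)
    show "(`) \<pi> ` W \<subseteq> Pow N" using sub im by blast
    show "N \<in> (`) \<pi> ` W" using mem[of N] im simple_gameD(2)[OF W] by simp
    show "{} \<notin> (`) \<pi> ` W" using mem[of "{}"] simple_gameD(3)[OF W] by simp
    fix S T assume "S \<in> (`) \<pi> ` W" "S \<subseteq> T" "T \<subseteq> N"
    moreover obtain T' where T': "T' \<subseteq> N" "T = \<pi> ` T'" using \<open>T \<subseteq> N\<close> im by (metis subset_imageE)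
    ultimately obtain S' where S': "S' \<in> W" "\<pi> ` S' \<subseteq> \<pi> ` T'" by blast
    then have "S' \<subseteq> N" using sub by blast
    then have "S' \<subseteq> T'"
      using b T' S'(2) inj_on_image_mem_iff[of \<pi> N _ T'] unfolding bij_betw_def by blast
    then have "T' \<in> W" using simple_gameD(4)[OF W S'(1)] T'(1) by simp
    then show "T \<in> (`) \<pi> ` W" using T'(2) by simp
  qed
  then show ?thesis using W b mem unfolding iso_by_def by blast
qed

text \<open>By finiteness every winning coalition contains a minimal one, which avoids a null
  player. Conversely, a minimal coalition containing \<open>i\<close> cannot stay winning without
  \<open>i\<close>.\<close>

lemma null_player_iff:
  assumes "finite N" "simple_game N W"
  shows "null_player W i \<longleftrightarrow> (\<forall>S \<in> W. S - {i} \<in> W)"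
proof
  assume null: "null_player W i"
  show "\<forall>S \<in> W. S - {i} \<in> W"
  proof
    fix S assume "S \<in> W"
    have "finite W"
      using assms by (auto simp: simple_game_def intro: finite_subset[of W "Pow N"])
    from finite_has_minimal2[OF this \<open>S \<in> W\<close>]
    obtain T where T: "T \<in> W" "T \<subseteq> S" "\<forall>R \<in> W. R \<subseteq> T \<longrightarrow> T = R" by blast
    then have "T \<in> minimal_winning W" by (auto simp: minimal_winning_def)
    then have "i \<notin> T" using null by (auto simp: null_player_def)
    then have "T \<subseteq> S - {i}" using T by blast
    then show "S - {i} \<in> W"
      using simple_gameD(4)[OF assms(2) T(1)] simple_gameD(1)[OF assms(2) \<open>S \<in> W\<close>] by blast
  qed
next
  assume "\<forall>S \<in> W. S - {i} \<in> W"
  then show "null_player W i" by (fastforce simp: null_player_def minimal_winning_def)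
qed

section \<open>Adding a player to a game with veto\<close>

definition ext :: "'a \<Rightarrow> 'a set set \<Rightarrow> 'a set set \<Rightarrow> 'a set set" where
  "ext k U B = insert k ` U \<union> B"

lemma insert_mem_ext:
  assumes "U \<subseteq> Pow N" "B \<subseteq> Pow N" "k \<notin> N" "S \<subseteq> N"
  shows "insert k S \<in> ext k U B \<longleftrightarrow> S \<in> U"
proof -
  have "S = T" if "insert k S = insert k T" "T \<in> U" for T
  proof -
    have "k \<notin> S" "k \<notin> T" using that(2) assms by auto
    then show ?thesis using that(1) by (simp add: insert_ident)
  qed
  then show ?thesis using assms by (auto simp: ext_def)
qed

lemma mem_ext:
  assumes "k \<notin> S"
  shows "S \<in> ext k U B \<longleftrightarrow> S \<in> B"
  using assms by (auto simp: ext_def)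

lemma subset_insert_cases:
  assumes "S \<subseteq> insert k N"
  obtains "S \<subseteq> N" | R where "R \<subseteq> N" "S = insert k R"
  using assms that by (metis subset_insert_iff subset_insert insert_Diff)

text \<open>\<open>B \<subseteq> U\<close> is exactly what monotonicity demands when
  \<open>k\<close> joins a coalition that wins without it.\<close>

lemma simple_game_ext:
  assumes U: "simple_game N U" and B: "simple_game N B" and "B \<subseteq> U" and k: "k \<notin> N"
  shows "simple_game (insert k N) (ext k U B)"
proof -
  have sub: "U \<subseteq> Pow N" "B \<subseteq> Pow N" using U B by (auto simp: simple_game_def)
  note insert_mem = insert_mem_ext[OF sub k]
  show ?thesis
    unfolding simple_game_def
  proof (intro conjI allI impI)
    show "ext k U B \<subseteq> Pow (insert k N)" using sub by (auto simp: ext_def)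
    show "insert k N \<in> ext k U B" using insert_mem simple_gameD(2)[OF U] by simp
    show "{} \<notin> ext k U B" using mem_ext[of k "{}" U B] simple_gameD(3)[OF B] by simp
    fix S T assume ST: "S \<in> ext k U B" "S \<subseteq> T" "T \<subseteq> insert k N"
    from ST(3) show "T \<in> ext k U B"
    proof (cases rule: subset_insert_cases)
      case 1
      then have "k \<notin> S" "k \<notin> T" using ST k by auto
      then show ?thesis using ST 1 mem_ext simple_gameD(4)[OF B] by metis
    next
      case (2 R)
      have "S - {k} \<subseteq> R" using ST 2 by blast
      moreover have "S - {k} \<in> U"
      proof (cases "k \<in> S")
        case True
        then have "insert k (S - {k}) \<in> ext k U B" using ST by (simp add: insert_absorb)
        then show ?thesis using insert_mem[of "S - {k}"] ST by blast
      next
        case False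
        then have "S \<in> U" using ST(1) mem_ext[OF False] \<open>B \<subseteq> U\<close> by blast
        then show ?thesis using False by simp
      qed
      ultimately show ?thesis using 2 insert_mem simple_gameD(4)[OF U] by blast
    qed
  qed
qed

section \<open>Games with veto and the extension scheme\<close>

definition veto_games :: "'a set \<Rightarrow> nat \<Rightarrow> 'a set set set" where
  "veto_games N t = {W. complete_game N W \<and> num_types N W = t \<and> (\<exists>i \<in> N. vetoer W i)}"

text \<open>\<open>Q\<close> receives the player set because semi-veto depends on it. On
  \<open>{1..n}\<close>, nullity and semi-veto for \<open>Q\<close> give the representatives of
  \<open>CGVN\<close> and \<open>CGVSV\<close>. General player sets allow induction on
  \<open>N\<close>.\<close>

definition veto_games_with ::
  "('a set \<Rightarrow> 'a set set \<Rightarrow> 'a \<Rightarrow> bool) \<Rightarrow> 'a set \<Rightarrow> nat \<Rightarrow> 'a set set set" where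
  "veto_games_with Q N t = {W \<in> veto_games N t. \<exists>i \<in> N. Q N W i}"

lemma veto_games_subset: "veto_games N t \<subseteq> {W. simple_game N W}"
  by (auto simp: veto_games_def complete_game_def)

lemma veto_games_with_subset: "veto_games_with Q N t \<subseteq> veto_games N t"
  by (auto simp: veto_games_with_def)

text \<open>A vetoer is a player, and a nonempty player set has at least one type.\<close>

lemma veto_games_0: "finite N \<Longrightarrow> veto_games N 0 = {}"
  by (auto simp: veto_games_def num_types_def finite_quotientI quotient_def)

lemma veto_games_empty: "veto_games {} t = {}"
  by (auto simp: veto_games_def)

text \<open>In \<open>ext k U (base N U)\<close> the coalitions with the new player \<open>k\<close> are governed by \<open>U\<close>, those
  without \<open>k\<close> by \<open>base N U\<close>. Taking \<open>base N U = U\<close> makes \<open>k\<close> null, \<open>base N U = {N}\<close> makes \<open>k\<close>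
  a semi-vetoer.\<close>

locale player_extension =
  fixes Q :: "'a set \<Rightarrow> 'a set set \<Rightarrow> 'a \<Rightarrow> bool"
    and base :: "'a set \<Rightarrow> 'a set set \<Rightarrow> 'a set set"
  assumes Q_iso: "finite N \<Longrightarrow> iso_by \<pi> N W W' \<Longrightarrow> i \<in> N \<Longrightarrow> Q N W i \<Longrightarrow> Q N W' (\<pi> i)"
    and Q_equal: "finite N \<Longrightarrow> simple_game N W \<Longrightarrow> i \<in> N \<Longrightarrow> j \<in> N \<Longrightarrow> Q N W i \<Longrightarrow> Q N W j \<Longrightarrow>
      (i, j) \<in> equally_desirable N W"
    and Q_not_vetoer: "finite N \<Longrightarrow> simple_game N W \<Longrightarrow> Q N W i \<Longrightarrow> \<not> vetoer W i"
    and base_simple: "simple_game N U \<Longrightarrow> simple_game N (base N U)"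
    and base_subset: "simple_game N U \<Longrightarrow> base N U \<subseteq> U"
    and base_iso: "iso_by \<pi> N U U' \<Longrightarrow> iso_by \<pi> N (base N U) (base N U')"
    and base_desirability: "simple_game N U \<Longrightarrow> (i, j) \<in> desirability N U \<Longrightarrow>
      (i, j) \<in> desirability N (base N U)"
    and Q_new: "finite N \<Longrightarrow> simple_game N U \<Longrightarrow> k \<notin> N \<Longrightarrow> Q (insert k N) (ext k U (base N U)) k"
    and Q_old: "finite N \<Longrightarrow> simple_game N U \<Longrightarrow> k \<notin> N \<Longrightarrow> i \<in> N \<Longrightarrow>
      Q (insert k N) (ext k U (base N U)) i \<longleftrightarrow> Q N U i"
    and new_comparable: "finite N \<Longrightarrow> simple_game N U \<Longrightarrow> k \<notin> N \<Longrightarrow> i \<in> N \<Longrightarrow>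
      (i, k) \<in> desirability (insert k N) (ext k U (base N U)) \<or>
      (k, i) \<in> desirability (insert k N) (ext k U (base N U))"
    and base_eq: "finite N \<Longrightarrow> k \<notin> N \<Longrightarrow> simple_game (insert k N) W \<Longrightarrow> Q (insert k N) W k \<Longrightarrow>
      S \<subseteq> N \<Longrightarrow> S \<in> W \<longleftrightarrow> S \<in> base N {S. S \<subseteq> N \<and> insert k S \<in> W}"
begin

context
  fixes N :: "'a set" and k :: 'a
  assumes fin: "finite N" and k: "k \<notin> N"
begin

abbreviation E :: "'a set set \<Rightarrow> 'a set set" where
  "E U \<equiv> ext k U (base N U)"

lemma insert_mem_E: "simple_game N U \<Longrightarrow> S \<subseteq> N \<Longrightarrow> insert k S \<in> E U \<longleftrightarrow> S \<in> U"
  using insert_mem_ext[of U N "base N U" k S] base_simple[of N U] k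
  by (auto simp: simple_game_def)

lemma mem_E: "S \<subseteq> N \<Longrightarrow> S \<in> E U \<longleftrightarrow> S \<in> base N U"
  using k by (intro mem_ext) blast

lemma simple_E: "simple_game N U \<Longrightarrow> simple_game (insert k N) (E U)"
  by (rule simple_game_ext[OF _ base_simple base_subset k])

lemma vetoer_E:
  assumes "simple_game N U" "vetoer U v"
  shows "vetoer (E U) v"
  using assms base_subset[of N U] by (auto simp: vetoer_def ext_def)

text \<open>Tests with \<open>k\<close> in the coalition repeat the tests in \<open>U\<close>; tests
  without \<open>k\<close> take place in \<open>base N U\<close>, where
  \<open>base_desirability\<close> keeps the order.\<close>

lemma desirability_E:
  assumes U: "simple_game N U" and ij: "i \<in> N" "j \<in> N"
  shows "(i, j) \<in> desirability (insert k N) (E U) \<longleftrightarrow> (i, j) \<in> desirability N U"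
proof
  assume d: "(i, j) \<in> desirability (insert k N) (E U)"
  show "(i, j) \<in> desirability N U"
  proof (rule desirabilityI)
    fix S assume S: "S \<subseteq> N" "i \<notin> S" "j \<notin> S" "insert j S \<in> U"
    then have "insert k (insert j S) \<in> E U" using insert_mem_E[OF U] ij by simp
    moreover have "insert k S \<subseteq> insert k N" "i \<notin> insert k S" "j \<notin> insert k S"
      using S ij k by auto
    ultimately have "insert k (insert i S) \<in> E U"
      using desirabilityD(3)[OF d, of "insert k S"] by (simp add: insert_commute)
    then show "insert i S \<in> U" using insert_mem_E[OF U] S ij by simp
  qed (use ij in auto)
next
  assume d: "(i, j) \<in> desirability N U"
  show "(i, j) \<in> desirability (insert k N) (E U)"
  proof (rule desirabilityI)
    fix S assume S: "S \<subseteq> insert k N" "i \<notin> S" "j \<notin> S" "insert j S \<in> E U"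
    from S(1) show "insert i S \<in> E U"
    proof (cases rule: subset_insert_cases)
      case 1
      then show ?thesis
        using desirabilityD(3)[OF base_desirability[OF U d], of S] S ij mem_E by simp
    next
      case (2 R)
      then have "insert k (insert j R) \<in> E U" using S by (simp add: insert_commute)
      then have "insert j R \<in> U" using insert_mem_E[OF U] 2 ij by simp
      then have "insert i R \<in> U" using desirabilityD(3)[OF d, of R] 2 S by simp
      then have "insert k (insert i R) \<in> E U" using insert_mem_E[OF U] 2 ij by simp
      then show ?thesis using 2 by (simp add: insert_commute)
    qed
  qed (use ij in auto)
qed

text \<open>Pairs of old players are settled by \<open>desirability_E\<close>, pairs involving
  \<open>k\<close> by \<open>new_comparable\<close>.\<close>

lemma complete_E:
  assumes U: "simple_game N U"
  shows "complete_game (insert k N) (E U) \<longleftrightarrow> complete_game N U"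
  using new_comparable[OF fin U k] simple_E[OF U] U
  by (auto simp: complete_game_iff desirability_E[OF U] desirability_refl)

text \<open>Old players keep their classes. The class of \<open>k\<close> consists of
  \<open>k\<close> and the old \<open>Q\<close>-players, so it is new precisely if there are none of
  these.\<close>

lemma num_types_E:
  assumes U: "simple_game N U"
  shows "num_types (insert k N) (E U) = num_types N U + (if \<exists>i \<in> N. Q N U i then 0 else 1)"
proof -
  let ?r = "equally_desirable N U" and ?s = "equally_desirable (insert k N) (E U)"
  note eq = equiv_equally_desirable[of "insert k N" "E U"]
  have rs: "(i, j) \<in> ?r \<longleftrightarrow> (i, j) \<in> ?s" if "i \<in> N" "j \<in> N" for i j
    using that desirability_E[OF U] by (simp add: equally_desirable_iff)
  have new: "(i, k) \<in> ?s \<longleftrightarrow> Q N U i" if i: "i \<in> N" for i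
  proof
    assume "(i, k) \<in> ?s"
    then have "(k, i) \<in> ?s" by (simp add: equally_desirable_iff)
    \<comment> \<open>This automorphism sends \<open>k\<close> to \<open>i\<close> and thereby
      carries \<open>Q\<close> from \<open>k\<close> to \<open>i\<close>.\<close>
    then have "iso_by (transpose k i) (insert k N) (E U) (E U)"
      by (rule iso_by_transpose[OF simple_E[OF U]])
    from Q_iso[OF _ this _ Q_new[OF fin U k]] show "Q N U i"
      using fin Q_old[OF fin U k i] by simp
  next
    assume "Q N U i"
    then show "(i, k) \<in> ?s"
      using Q_equal[OF _ simple_E[OF U], of i k] Q_old[OF fin U k i] Q_new[OF fin U k] fin i by simp
  qed
  show ?thesis
  proof (cases "\<exists>i \<in> N. Q N U i")
    case True
    \<comment> \<open>The inclusion of \<open>N\<close> reaches every class, since the class of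
      \<open>k\<close> contains an old player.\<close>
    have "card (N // ?r) = card (insert k N // ?s)"
    proof (rule card_quotient_eq[where f = id, OF equiv_equally_desirable eq])
      fix b assume "b \<in> insert k N"
      then show "\<exists>a \<in> N. (id a, b) \<in> ?s"
        using True new desirability_refl[of b "insert k N" "E U"] equally_desirable_iff[of b b]
        by auto
    qed (use rs in auto)
    then show ?thesis using True by (simp add: num_types_def)
  next
    case False
    have "card (N // ?r) = card (N // ?s)"
    proof (rule card_quotient_eq[where f = id, OF equiv_equally_desirable eq])
      fix b assume "b \<in> N"
      then show "\<exists>a \<in> N. (id a, b) \<in> ?s"
        by (intro bexI[of _ b]) (simp_all add: equally_desirable_iff desirability_refl)
    qed (use rs in auto)
    moreover have "card ((N \<union> {k}) // ?s) = card (N // ?s) + card ({k} // ?s)"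
      by (rule card_quotient_Un[OF eq]) (use False new fin in auto)
    moreover have "card ({k} // ?s) = 1" by (simp add: quotient_def)
    ultimately show ?thesis using False by (simp add: num_types_def)
  qed
qed

text \<open>\<open>\<pi>\<close> is constrained on \<open>N\<close> only, so its value at
  \<open>k\<close> has to be set. Coalitions without \<open>k\<close> are handled by
  \<open>base_iso\<close>.\<close>

lemma iso_E:
  assumes iso: "iso_by \<pi> N U U'"
  shows "iso_by (\<pi>(k := k)) (insert k N) (E U) (E U')"
  unfolding iso_by_def
proof (intro conjI allI impI)
  have U: "simple_game N U" "simple_game N U'" and b: "bij_betw \<pi> N N"
    using iso by (auto simp: iso_by_def)
  show "simple_game (insert k N) (E U)" "simple_game (insert k N) (E U')"
    using U simple_E by auto
  have "bij_betw (\<pi>(k := k)) N N" using b k by (metis bij_betw_cong fun_upd_other)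
  then show "bij_betw (\<pi>(k := k)) (insert k N) (insert k N)"
    using notIn_Un_bij_betw[of k N "\<pi>(k := k)" N] k by simp
  fix S assume "S \<subseteq> insert k N"
  then show "S \<in> E U \<longleftrightarrow> \<pi>(k := k) ` S \<in> E U'"
  proof (cases rule: subset_insert_cases)
    case 1
    then have "\<pi>(k := k) ` S = \<pi> ` S" "\<pi> ` S \<subseteq> N"
      using k b by (auto simp: bij_betw_def)
    then show ?thesis using 1 base_iso[OF iso] mem_E by (simp add: iso_by_def)
  next
    case (2 R)
    then have "\<pi>(k := k) ` S = insert k (\<pi> ` R)" "\<pi> ` R \<subseteq> N"
      using k b by (auto simp: bij_betw_def)
    then show ?thesis using 2 iso insert_mem_E U by (simp add: iso_by_def)
  qed
qed

text \<open>An isomorphism of extensions may move \<open>k\<close>, but only to a player equivalent to it, so it can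
  be corrected by a transposition.\<close>

lemma iso_E_rev:
  assumes U: "simple_game N U" "simple_game N U'" and iso: "iso_by \<sigma> (insert k N) (E U) (E U')"
  shows "(U, U') \<in> game_iso N"
proof -
  have "Q (insert k N) (E U') (\<sigma> k)" "\<sigma> k \<in> insert k N"
    using Q_iso[OF _ iso] Q_new[OF fin U(1) k] fin iso_by_in[OF iso] by auto
  then have "(\<sigma> k, k) \<in> equally_desirable (insert k N) (E U')"
    using Q_equal[OF _ simple_E[OF U(2)]] Q_new[OF fin U(2) k] fin by simp
  from iso_by_comp[OF iso iso_by_transpose[OF simple_E[OF U(2)] this]]
  obtain \<pi> where iso': "iso_by \<pi> (insert k N) (E U) (E U')" and \<pi>: "\<pi> k = k"
    by (metis comp_apply transpose_apply_first)
  have b: "bij_betw \<pi> (insert k N) (insert k N)" using iso' by (simp add: iso_by_def)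
  then have bN: "bij_betw \<pi> N N"
    using notIn_Un_bij_betw3[of k N \<pi> N] k \<pi> by simp
  have "S \<in> U \<longleftrightarrow> \<pi> ` S \<in> U'" if "S \<subseteq> N" for S
  proof -
    have "\<pi> ` S \<subseteq> N" using bN that by (auto simp: bij_betw_def)
    have "S \<in> U \<longleftrightarrow> insert k S \<in> E U" using insert_mem_E U that by simp
    also have "\<dots> \<longleftrightarrow> \<pi> ` insert k S \<in> E U'"
      using iso' that unfolding iso_by_def by (meson insert_mono)
    also have "\<dots> \<longleftrightarrow> insert k (\<pi> ` S) \<in> E U'" using \<pi> by simp
    also have "\<dots> \<longleftrightarrow> \<pi> ` S \<in> U'" using insert_mem_E U \<open>\<pi> ` S \<subseteq> N\<close> by simp
    finally show ?thesis .
  qed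
  then have "iso_by \<pi> N U U'" using U bN by (simp add: iso_by_def)
  then show ?thesis using game_iso_iff by blast
qed

text \<open>\<open>U\<close> is read off from the winning coalitions containing \<open>k\<close>,
  and \<open>base_eq\<close> recovers the others. A vetoer \<open>v\<close> differs from
  \<open>k\<close> by \<open>Q_not_vetoer\<close> and so stays a vetoer of \<open>U\<close>; this
  keeps \<open>{}\<close> out of \<open>U\<close>.\<close>

lemma ex_E:
  assumes W: "simple_game (insert k N) W" and Q: "Q (insert k N) W k" and v: "vetoer W v"
    and vN: "v \<in> insert k N"
  obtains U where "simple_game N U" "vetoer U v" "v \<in> N" "W = E U"
proof -
  let ?U = "{S. S \<subseteq> N \<and> insert k S \<in> W}"
  have "v \<noteq> k" using Q_not_vetoer[OF _ W Q] fin v by auto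
  then have vet: "vetoer ?U v" using v by (auto simp: vetoer_def)
  have U: "simple_game N ?U"
    unfolding simple_game_def
  proof (intro conjI allI impI)
    show "N \<in> ?U" using simple_gameD(2)[OF W] by simp
    show "{} \<notin> ?U" using vet by (auto simp: vetoer_def)
    fix S T assume "S \<in> ?U" "S \<subseteq> T" "T \<subseteq> N"
    then show "T \<in> ?U" using simple_gameD(4)[OF W, of "insert k S" "insert k T"] by auto
  qed auto
  have "S \<in> W \<longleftrightarrow> S \<in> E ?U" if "S \<subseteq> insert k N" for S
    using that
  proof (cases rule: subset_insert_cases)
    case 1
    then show ?thesis using base_eq[OF fin k W Q 1] mem_E[OF 1] by simp
  next
    case (2 R)
    then show ?thesis using insert_mem_E[OF U, of R] by simp
  qed
  then have "W = E ?U" using simple_gameD(1)[OF W] simple_gameD(1)[OF simple_E[OF U]] by blast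
  then show thesis using that[OF U vet] vN \<open>v \<noteq> k\<close> by blast
qed

text \<open>Up to isomorphism, \<open>E\<close> maps onto \<open>?B\<close> from two sources: games
  with \<open>Suc t\<close> types that already have a \<open>Q\<close>-player, and games with
  \<open>t\<close> types that have none. The difference counts the second source, so the subtraction
  is never truncated.\<close>

lemma card_veto_games_with_insert:
  "card (veto_games_with Q (insert k N) (Suc t) // game_iso (insert k N)) =
     card (veto_games_with Q N (Suc t) // game_iso N) +
     (card (veto_games N t // game_iso N) - card (veto_games_with Q N t // game_iso N))"
proof -
  let ?C = "veto_games_with Q N (Suc t)" and ?D = "veto_games N t - veto_games_with Q N t"
  let ?B = "veto_games_with Q (insert k N) (Suc t)"
  have fin_veto: "finite (veto_games N t)" for t
    using finite_subset[OF veto_games_subset finite_simple_games[OF fin]] .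
  have Qiso: "(\<exists>i \<in> N. Q N W' i)" if "(W, W') \<in> game_iso N" "\<exists>i \<in> N. Q N W i" for W W'
    using that Q_iso[OF fin] iso_by_in unfolding game_iso_iff by metis
  have sub: "veto_games N t \<subseteq> {W. simple_game N W}" "veto_games_with Q N t \<subseteq> {W. simple_game N W}" for t
    using veto_games_subset veto_games_with_subset by blast+
  \<comment> \<open>The number \<open>s\<close> is left free since the separation from
    \<open>?D\<close> is used both for \<open>Suc t\<close> and for \<open>t\<close>.\<close>
  have Qiso': "(W, W') \<notin> game_iso N" if "W \<in> veto_games_with Q N s" "W' \<in> ?D" for W W' s
    using that Qiso[of W W'] by (auto simp: veto_games_with_def)
  \<comment> \<open>By \<open>num_types_E\<close>, \<open>E U\<close> has \<open>Suc t\<close> types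
    in exactly the two cases \<open>?C\<close> and \<open>?D\<close>.\<close>
  have in_B: "E U \<in> ?B \<longleftrightarrow> U \<in> ?C \<union> ?D" if U: "simple_game N U" and v: "\<exists>v \<in> N. vetoer U v" for U
  proof -
    have "\<exists>v \<in> insert k N. vetoer (E U) v" using v vetoer_E[OF U] by blast
    moreover have "\<exists>i \<in> insert k N. Q (insert k N) (E U) i" using Q_new[OF fin U k] by blast
    ultimately show ?thesis
      using v by (auto simp: veto_games_with_def veto_games_def num_types_E[OF U] complete_E[OF U])
  qed
  have subD: "?D \<subseteq> {W. simple_game N W}" using veto_games_subset by blast
  have fin_with: "finite (veto_games_with Q N t)" for t
    using finite_subset[OF veto_games_with_subset fin_veto] .
  have AD: "simple_game N U \<and> (\<exists>v \<in> N. vetoer U v)" if "U \<in> ?C \<union> ?D" for U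
    using that by (auto simp: veto_games_with_def veto_games_def complete_game_def)
  have "card ((?C \<union> ?D) // game_iso N) = card (?B // game_iso (insert k N))"
  proof (rule card_quotient_eq[OF equiv_game_iso equiv_game_iso, where f = E])
    show "?C \<union> ?D \<subseteq> {W. simple_game N W}" using sub by blast
    show "?B \<subseteq> {W. simple_game (insert k N) W}"
      using veto_games_subset veto_games_with_subset by blast
    show "E U \<in> ?B" if "U \<in> ?C \<union> ?D" for U
      using in_B AD that by blast
    show "(U, U') \<in> game_iso N \<longleftrightarrow> (E U, E U') \<in> game_iso (insert k N)"
      if "U \<in> ?C \<union> ?D" "U' \<in> ?C \<union> ?D" for U U'
      using iso_E iso_E_rev AD[OF that(1)] AD[OF that(2)] game_iso_iff by metis
    fix W assume W: "W \<in> ?B"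
    then obtain v j where sW: "simple_game (insert k N) W"
      and j: "j \<in> insert k N" "Q (insert k N) W j" and v: "v \<in> insert k N" "vetoer W v"
      by (auto simp: veto_games_with_def veto_games_def complete_game_def)
    \<comment> \<open>The \<open>Q\<close>-player \<open>j\<close> need not be \<open>k\<close>;
      after renaming it to \<open>k\<close>, \<open>ex_E\<close> applies to the isomorphic
      game.\<close>
    let ?\<pi> = "transpose j k"
    obtain W1 where iso: "iso_by ?\<pi> (insert k N) W W1"
      using iso_by_image[OF sW, of ?\<pi>] j by auto
    have sW1: "simple_game (insert k N) W1" using iso by (simp add: iso_by_def)
    have Q1: "Q (insert k N) W1 k" using Q_iso[OF _ iso j] fin by simp
    have v1: "vetoer W1 (?\<pi> v)" "?\<pi> v \<in> insert k N"
      using vetoer_iso[OF iso v(2)] iso_by_in[OF iso v(1)] .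
    obtain U where U: "simple_game N U" "vetoer U (?\<pi> v)" "?\<pi> v \<in> N" "W1 = E U"
      by (rule ex_E[OF sW1 Q1 v1])
    have "W1 \<in> ?B"
      using W iso Q1 v1 complete_game_iso[OF iso] num_types_iso[OF iso]
      by (auto simp: veto_games_with_def veto_games_def)
    then have "U \<in> ?C \<union> ?D" using in_B U by blast
    moreover have "(E U, W) \<in> game_iso (insert k N)"
      using iso_by_inv[OF iso] U(4) game_iso_iff by blast
    ultimately show "\<exists>U \<in> ?C \<union> ?D. (E U, W) \<in> game_iso (insert k N)" by blast
  qed
  moreover have "card ((?C \<union> ?D) // game_iso N) = card (?C // game_iso N) + card (?D // game_iso N)"
    by (rule card_quotient_Un[OF equiv_game_iso])
      (fact sub subD fin_with finite_Diff[OF fin_veto] Qiso')+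
  \<comment> \<open>This splitting of \<open>veto_games N t\<close> turns the count of
    \<open>?D\<close> into the difference in the claim.\<close>
  moreover have "card ((veto_games_with Q N t \<union> ?D) // game_iso N) =
      card (veto_games_with Q N t // game_iso N) + card (?D // game_iso N)"
    by (rule card_quotient_Un[OF equiv_game_iso])
      (fact sub subD fin_with finite_Diff[OF fin_veto] Qiso')+
  moreover have "veto_games_with Q N t \<union> ?D = veto_games N t"
    using veto_games_with_subset by blast
  ultimately show ?thesis by simp
qed

end

end

section \<open>Adding a null player\<close>

interpretation null: player_extension "\<lambda>N. null_player" "\<lambda>N U. U"
proof
  fix N :: "'a set" and W W' \<pi> i
  assume N: "finite N" and iso: "iso_by \<pi> N W W'" and i: "i \<in> N" and null: "null_player W i"
  have W: "simple_game N W" "simple_game N W'" using iso by (auto simp: iso_by_def)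
  show "null_player W' (\<pi> i)"
    unfolding null_player_iff[OF N W(2)]
  proof
    fix S assume "S \<in> W'"
    then obtain R where R: "R \<in> W" "R \<subseteq> N" "S = \<pi> ` R" by (rule iso_by_setE[OF iso])
    then have "R - {i} \<in> W" using null null_player_iff[OF N W(1)] by blast
    moreover have "R - {i} \<subseteq> N" using R by blast
    ultimately have "\<pi> ` (R - {i}) \<in> W'" using iso by (simp add: iso_by_def)
    then show "S - {\<pi> i} \<in> W'" using iso_by_image_Diff[OF iso R(2) i] R by simp
  qed
next
  fix N :: "'a set" and W i j
  assume N: "finite N" and W: "simple_game N W" and ij: "i \<in> N" "j \<in> N"
    and null: "null_player W i" "null_player W j"
  \<comment> \<open>Every player is at least as desirable as a null player; two null players use
    this both ways.\<close>
  have "(i, j) \<in> desirability N W"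
    if ij: "i \<in> N" "j \<in> N" and j: "null_player W j" for i j
  proof (rule desirabilityI[OF ij])
    fix S assume S: "S \<subseteq> N" "i \<notin> S" "j \<notin> S" "insert j S \<in> W"
    then have "S \<in> W" using j null_player_iff[OF N W, of j] by fastforce
    then show "insert i S \<in> W" using simple_gameD(4)[OF W, of S "insert i S"] S ij by blast
  qed
  then show "(i, j) \<in> equally_desirable N W"
    using ij null by (simp add: equally_desirable_iff)
next
  fix N :: "'a set" and W i
  assume "finite N" "simple_game N W" "null_player W i"
  then have "N - {i} \<in> W" using null_player_iff[of N W i] simple_gameD(2)[of N W] by simp
  then show "\<not> vetoer W i" by (auto simp: vetoer_def)
next
  fix N :: "'a set" and U k
  assume N: "finite N" and U: "simple_game N U" and k: "k \<notin> N"
  have notin: "k \<notin> S" if "S \<in> U" for S using simple_gameD(1)[OF U that] k by blast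
  \<comment> \<open>Winning is decided by what remains after dropping \<open>k\<close>.\<close>
  have mem: "S \<in> ext k U U \<longleftrightarrow> S - {k} \<in> U" for S
  proof (cases "k \<in> S")
    case True
    then have "S = insert k (S - {k})" by blast
    then show ?thesis
      using True notin by (fastforce simp: ext_def intro: image_eqI[where x = "S - {k}"])
  qed (simp add: mem_ext)
  have E: "simple_game (insert k N) (ext k U U)" by (rule simple_game_ext[OF U U _ k]) simp
  have iff: "null_player (ext k U U) i \<longleftrightarrow> (\<forall>S. S - {k} \<in> U \<longrightarrow> S - {i} - {k} \<in> U)" for i
    using null_player_iff[OF _ E, of i] N by (simp add: mem Ball_def)
  show "null_player (ext k U U) k" by (simp add: iff)
  show "null_player (ext k U U) i \<longleftrightarrow> null_player U i" for i
  proof -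
    \<comment> \<open>Deleting \<open>i\<close> commutes with deleting \<open>k\<close>, so nullity
      of \<open>i\<close> becomes a condition on \<open>U\<close>.\<close>
    have "S - {i} - {k} = S - {k} - {i}" for S by blast
    then have "(\<forall>S. S - {k} \<in> U \<longrightarrow> S - {i} - {k} \<in> U) \<longleftrightarrow> (\<forall>S \<in> U. S - {i} \<in> U)"
      using notin by (metis Diff_empty Diff_insert0)
    then show ?thesis by (simp add: iff null_player_iff[OF N U])
  qed
  show "(i, k) \<in> desirability (insert k N) (ext k U U) \<or>
      (k, i) \<in> desirability (insert k N) (ext k U U)" if i: "i \<in> N" for i
  \<comment> \<open>The null player \<open>k\<close> is the weaker one: if \<open>S\<close> wins
    with \<open>k\<close>, it wins alone and hence with \<open>i\<close>.\<close>
  proof (intro disjI1 desirabilityI)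
    fix S assume S: "i \<notin> S" "k \<notin> S" "insert k S \<in> ext k U U"
    then have "S \<in> U" by (simp add: mem)
    then have "insert i S \<in> U"
      using simple_gameD(1,4)[OF U \<open>S \<in> U\<close>] i by blast
    then show "insert i S \<in> ext k U U" by (simp add: ext_def)
  qed (use i in auto)
next
  fix N :: "'a set" and W k S
  assume N: "finite N" "k \<notin> N" and W: "simple_game (insert k N) W" and null: "null_player W k"
    and S: "S \<subseteq> N"
  have "insert k S - {k} = S" using N S by blast
  then have "insert k S \<in> W \<Longrightarrow> S \<in> W"
    using null_player_iff[OF _ W, of k] null N by fastforce
  moreover have "S \<in> W \<Longrightarrow> insert k S \<in> W"
    using simple_gameD(4)[OF W, of S "insert k S"] S by blast
  ultimately show "S \<in> W \<longleftrightarrow> S \<in> {S. S \<subseteq> N \<and> insert k S \<in> W}" using S by blast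
qed auto

section \<open>Adding a semi-vetoer\<close>

lemma semi_vetoer_desirability:
  assumes W: "simple_game N W" and ij: "i \<in> N" "j \<in> N" and "semi_vetoer N W i" "semi_vetoer N W j"
  shows "(i, j) \<in> desirability N W"
proof (cases "i = j")
  case True
  then show ?thesis using ij by (simp add: desirability_refl)
next
  case False
  show ?thesis
  proof (rule desirabilityI[OF ij])
    fix S assume S: "S \<subseteq> N" "i \<notin> S" "j \<notin> S" "insert j S \<in> W"
    \<comment> \<open>A winning coalition missing the semi-vetoer \<open>i\<close> must be
      \<open>N - {i}\<close>; exchanging \<open>j\<close> for \<open>i\<close> then yields
      \<open>N - {j}\<close>, which wins because \<open>j\<close> is a semi-vetoer.\<close>
    then have "insert j S = N - {i}" using assms False by (auto simp: semi_vetoer_def)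
    then have "S = N - {i} - {j}" using S by blast
    then have "insert i S = N - {j}" using False ij by blast
    then show "insert i S \<in> W" using assms by (simp add: semi_vetoer_def)
  qed
qed

text \<open>The base does not vary with \<open>U\<close>: without a semi-vetoer only the coalition
  of all other players wins.\<close>

interpretation semi: player_extension semi_vetoer "\<lambda>N U. {N}"
proof
  fix N :: "'a set" and W W' \<pi> i
  assume iso: "iso_by \<pi> N W W'" and i: "i \<in> N" and semi: "semi_vetoer N W i"
  have im: "\<pi> ` (N - {i}) = N - {\<pi> i}"
    using iso_by_image_Diff[OF iso _ i, of N] iso by (auto simp: iso_by_def bij_betw_def)
  show "semi_vetoer N W' (\<pi> i)"
    unfolding semi_vetoer_def
  proof (intro conjI ballI impI)
    show "N - {\<pi> i} \<in> W'"
      using iso semi im unfolding iso_by_def semi_vetoer_def by (metis Diff_subset)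
    fix S assume S: "S \<in> W'" "S \<noteq> N - {\<pi> i}"
    obtain R where R: "R \<in> W" "R \<subseteq> N" "S = \<pi> ` R" by (rule iso_by_setE[OF iso S(1)])
    then have "R \<noteq> N - {i}" using S(2) im by auto
    then have "i \<in> R" using semi R(1) by (simp add: semi_vetoer_def)
    then show "\<pi> i \<in> S" using R(3) by blast
  qed
next
  fix N :: "'a set" and W i j
  assume "simple_game N W" "i \<in> N" "j \<in> N" "semi_vetoer N W i" "semi_vetoer N W j"
  then show "(i, j) \<in> equally_desirable N W"
    by (simp add: equally_desirable_iff semi_vetoer_desirability)
next
  fix N :: "'a set" and W i
  assume "semi_vetoer N W i"
  then show "\<not> vetoer W i" by (auto simp: semi_vetoer_def vetoer_def)
next
  fix N :: "'a set" and U assume U: "simple_game N U"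
  then show simp: "simple_game N {N}" by (auto simp: simple_game_def)
  show "{N} \<subseteq> U" using simple_gameD(2)[OF U] by simp
  show "(i, j) \<in> desirability N {N}" if "(i, j) \<in> desirability N U" for i j
    using desirabilityD(1,2)[OF that] by (auto intro!: desirabilityI)
  fix k assume k: "k \<notin> N"
  have N: "insert k N - {k} = N" using k by simp
  have sub: "S \<subseteq> N" if "S \<in> U" for S using simple_gameD(1)[OF U that] .
  show "semi_vetoer (insert k N) (ext k U {N}) k"
    by (auto simp: semi_vetoer_def N ext_def)
  show "semi_vetoer (insert k N) (ext k U {N}) i \<longleftrightarrow> semi_vetoer N U i" if i: "i \<in> N" for i
  proof -
    \<comment> \<open>The only winning coalition without \<open>k\<close> is \<open>N\<close>, which
      contains \<open>i\<close>. So semi-veto of \<open>i\<close> is decided by the coalitions with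
      \<open>k\<close>, which mirror \<open>U\<close>.\<close>
    have ki: "insert k N - {i} = insert k (N - {i})" using i k by blast
    have mem: "insert k S \<in> ext k U {N} \<longleftrightarrow> S \<in> U" if "S \<subseteq> N" for S
      using insert_mem_ext[of U N "{N}" k S] sub k that by auto
    have eq: "insert k S = insert k (N - {i}) \<longleftrightarrow> S = N - {i}" if "S \<in> U" for S
      using sub[OF that] k by (intro insert_ident) auto
    show ?thesis
      using i k mem[of "N - {i}"] eq unfolding semi_vetoer_def ki by (auto simp: ext_def)
  qed
  show "(i, k) \<in> desirability (insert k N) (ext k U {N}) \<or>
      (k, i) \<in> desirability (insert k N) (ext k U {N})" if i: "i \<in> N" for i
  \<comment> \<open>If \<open>N - {i}\<close> wins in \<open>U\<close>, then \<open>k\<close> is at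
    least as desirable as \<open>i\<close>, the only test coalition being \<open>N - {i}\<close>.
    Otherwise no subset of \<open>N - {i}\<close> wins in \<open>U\<close>, and \<open>i\<close>
    dominates \<open>k\<close> vacuously.\<close>
  proof (cases "N - {i} \<in> U")
    case True
    have "(k, i) \<in> desirability (insert k N) (ext k U {N})"
    proof (rule desirabilityI)
      fix S assume S: "k \<notin> S" "i \<notin> S" "insert i S \<in> ext k U {N}"
      moreover have "k \<notin> insert i S" using S i k by blast
      ultimately have "insert i S = N" by (simp add: mem_ext)
      then have "S = N - {i}" using S by blast
      then show "insert k S \<in> ext k U {N}" using True by (simp add: ext_def)
    qed (use i in auto)
    then show ?thesis ..
  next
    case False
    have "(i, k) \<in> desirability (insert k N) (ext k U {N})"
    proof (rule desirabilityI)
      fix S assume S: "S \<subseteq> insert k N" "i \<notin> S" "k \<notin> S" "insert k S \<in> ext k U {N}"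
      then have "S \<subseteq> N - {i}" by blast
      moreover have "S \<in> U"
        using insert_mem_ext[of U N "{N}" k S] sub k S \<open>S \<subseteq> N - {i}\<close> by auto
      ultimately have False using False simple_gameD(4)[OF U, of S "N - {i}"] by blast
      then show "insert i S \<in> ext k U {N}" ..
    qed (use i in auto)
    then show ?thesis ..
  qed
next
  fix N :: "'a set" and U U' \<pi>
  assume "iso_by \<pi> N U U'"
  then have "simple_game N U" and b: "bij_betw \<pi> N N" by (auto simp: iso_by_def)
  then have "simple_game N {N}" by (auto simp: simple_game_def)
  moreover have "S = N \<longleftrightarrow> \<pi> ` S = N" if "S \<subseteq> N" for S
    using b that unfolding bij_betw_def by (metis inj_on_image_eq_iff order_refl)
  ultimately show "iso_by \<pi> N {N} {N}" using b by (simp add: iso_by_def)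
next
  fix N :: "'a set" and W k S
  assume k: "k \<notin> N" and W: "simple_game (insert k N) W" and semi: "semi_vetoer (insert k N) W k"
    and S: "S \<subseteq> N"
  have "insert k N - {k} = N" using k by simp
  then show "S \<in> W \<longleftrightarrow> S \<in> {N}" using semi S k by (auto simp: semi_vetoer_def)
qed

text \<open>Both instances satisfy the same recursion with the same counts of
  \<open>veto_games\<close>. The number of types is generalized because the recursion at
  \<open>Suc s\<close> refers to \<open>Suc s\<close> and \<open>s\<close>.\<close>

lemma card_veto_null_eq_semi:
  assumes "finite N"
  shows "card (veto_games_with (\<lambda>N. null_player) N t // game_iso N) =
    card (veto_games_with semi_vetoer N t // game_iso N)"
  using assms
proof (induction N arbitrary: t rule: finite_induct)
  case empty
  then show ?case using veto_games_empty veto_games_with_subset by (metis subset_empty)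
next
  case (insert k N)
  show ?case
  proof (cases t)
    case 0
    then show ?thesis
      using veto_games_0[of "insert k N"] veto_games_with_subset insert by (metis finite_insert subset_empty)
  next
    case (Suc s)
    then show ?thesis
      using insert
      by (simp add: null.card_veto_games_with_insert semi.card_veto_games_with_insert)
  qed
qed

section \<open>Duality\<close>

definition dual :: "'a set \<Rightarrow> 'a set set \<Rightarrow> 'a set set" where
  "dual N W = {S. S \<subseteq> N \<and> N - S \<notin> W}"

lemma dual_dual: "simple_game N W \<Longrightarrow> dual N (dual N W) = W"
  by (fastforce simp: dual_def double_diff simple_game_def)

lemma simple_dual:
  assumes W: "simple_game N W"
  shows "simple_game N (dual N W)"
  unfolding simple_game_def
proof (intro conjI allI impI)
  fix S T assume ST: "S \<in> dual N W" "S \<subseteq> T" "T \<subseteq> N"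
  then show "T \<in> dual N W"
    using simple_gameD(4)[OF W, of "N - T" "N - S"] by (auto simp: dual_def)
qed (use simple_gameD(2,3)[OF W] in \<open>auto simp: dual_def\<close>)

lemma iso_dual:
  assumes iso: "iso_by \<pi> N W W'"
  shows "iso_by \<pi> N (dual N W) (dual N W')"
  unfolding iso_by_def
proof (intro conjI allI impI)
  show "simple_game N (dual N W)" "simple_game N (dual N W')" and b: "bij_betw \<pi> N N"
    using iso simple_dual by (auto simp: iso_by_def)
  fix S assume S: "S \<subseteq> N"
  have "\<pi> ` S \<subseteq> N" using b S unfolding bij_betw_def by blast
  moreover have "\<pi> ` (N - S) = N - \<pi> ` S"
    using b S inj_on_image_set_diff[of \<pi> N N S] by (simp add: bij_betw_def)
  moreover have "N - S \<in> W \<longleftrightarrow> \<pi> ` (N - S) \<in> W'" using iso by (simp add: iso_by_def)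
  ultimately show "S \<in> dual N W \<longleftrightarrow> \<pi> ` S \<in> dual N W'" using S by (simp add: dual_def)
qed

lemma desirability_dual:
  assumes W: "simple_game N W"
  shows "desirability N (dual N W) = desirability N W"
proof -
  have *: "(i, j) \<in> desirability N (dual N W)" if d: "(i, j) \<in> desirability N W" for i j W
  proof (rule desirabilityI)
    show N: "i \<in> N" "j \<in> N" using desirabilityD[OF d] by auto
    fix S assume S: "S \<subseteq> N" "i \<notin> S" "j \<notin> S" "insert j S \<in> dual N W"
    show "insert i S \<in> dual N W"
    proof (cases "i = j")
      case False
      let ?R = "N - S - {i, j}"
      \<comment> \<open>Complementation exchanges the two players in a test and also winning with
        losing, so the contrapositive of the test in \<open>W\<close> has the right
        direction.\<close>
      have "N - insert j S = insert i ?R" "N - insert i S = insert j ?R" using False S N by auto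
      then show ?thesis using S N desirabilityD(3)[OF d, of ?R] by (auto simp: dual_def)
    qed (use S in simp)
  qed
  then show ?thesis using *[of _ _ W] *[of _ _ "dual N W"] dual_dual[OF W] by auto
qed

lemma complete_dual:
  "simple_game N W \<Longrightarrow> complete_game N (dual N W) \<longleftrightarrow> complete_game N W"
  by (simp add: complete_game_iff desirability_dual simple_dual)

lemma num_types_dual:
  assumes "simple_game N W"
  shows "num_types N (dual N W) = num_types N W"
proof -
  have "equally_desirable N (dual N W) = equally_desirable N W"
    using assms by (auto simp: equally_desirable_iff desirability_dual)
  then show ?thesis by (simp add: num_types_def)
qed

lemma passer_dual:
  assumes "simple_game N W" "i \<in> N"
  shows "passer (dual N W) i \<longleftrightarrow> vetoer W i"
proof -
  \<comment> \<open>By monotonicity the single coalition \<open>N - {i}\<close> decides whether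
    \<open>i\<close> has veto.\<close>
  have "N - {i} \<in> W" if "S \<in> W" "i \<notin> S" for S
    using simple_gameD(4)[OF assms(1) that(1), of "N - {i}"]
      simple_gameD(1)[OF assms(1) that(1)] that(2) by blast
  then show ?thesis using assms(2) unfolding passer_def dual_def vetoer_def by blast
qed

lemma null_player_dual:
  assumes N: "finite N" and W: "simple_game N W"
  shows "null_player (dual N W) i \<longleftrightarrow> null_player W i"
proof -
  have *: "null_player (dual N W) i" if W: "simple_game N W" and "null_player W i" for W
    unfolding null_player_iff[OF N simple_dual[OF W]]
  proof
    fix S assume S: "S \<in> dual N W"
    \<comment> \<open>Proved contrapositively: removing the null player \<open>i\<close> from the
      complement of \<open>S - {i}\<close> leaves a winning subset of \<open>N - S\<close>.\<close>
    have "N - S \<in> W" if "N - (S - {i}) \<in> W"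
    proof -
      have "N - (S - {i}) - {i} \<in> W" using that \<open>null_player W i\<close> null_player_iff[OF N W] by blast
      then show ?thesis using simple_gameD(4)[OF W, of "N - (S - {i}) - {i}" "N - S"] by blast
    qed
    then show "S - {i} \<in> dual N W" using S by (auto simp: dual_def)
  qed
  then show ?thesis using *[OF W] *[OF simple_dual[OF W]] dual_dual[OF W] by auto
qed

lemma semi_passer_dual:
  assumes W: "simple_game N W" and i: "i \<in> N"
  shows "semi_passer N (dual N W) i \<longleftrightarrow> semi_vetoer N W i"
proof -
  have "(\<forall>j \<in> N. j \<noteq> i \<longrightarrow> N - {i, j} \<notin> W) \<longleftrightarrow> (\<forall>S \<in> W. S \<noteq> N - {i} \<longrightarrow> i \<in> S)"
  proof
    assume L: "\<forall>j \<in> N. j \<noteq> i \<longrightarrow> N - {i, j} \<notin> W"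
    show "\<forall>S \<in> W. S \<noteq> N - {i} \<longrightarrow> i \<in> S"
    proof (intro ballI impI, rule ccontr)
      fix S assume S: "S \<in> W" "S \<noteq> N - {i}" "i \<notin> S"
      then have "S \<subseteq> N - {i}" using simple_gameD(1)[OF W] by blast
      \<comment> \<open>A winning \<open>S\<close> without \<open>i\<close> other than
        \<open>N - {i}\<close> misses a further player \<open>j\<close>, so the larger
        \<open>N - {i, j}\<close> wins. Hence these coalitions suffice for testing
        semi-veto.\<close>
      then obtain j where j: "j \<in> N" "j \<noteq> i" "j \<notin> S" using S by blast
      then have "N - {i, j} \<in> W"
        using simple_gameD(4)[OF W S(1), of "N - {i, j}"] \<open>S \<subseteq> N - {i}\<close> by blast
      then show False using L j by blast
    qed
  next
    assume R: "\<forall>S \<in> W. S \<noteq> N - {i} \<longrightarrow> i \<in> S"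
    show "\<forall>j \<in> N. j \<noteq> i \<longrightarrow> N - {i, j} \<notin> W"
    proof (intro ballI impI notI)
      fix j assume j: "j \<in> N" "j \<noteq> i" "N - {i, j} \<in> W"
      have "j \<in> N - {i}" "j \<notin> N - {i, j}" using j by simp_all
      then have "N - {i, j} \<noteq> N - {i}" by metis
      then have "i \<in> N - {i, j}" using bspec[OF R j(3)] by (rule mp[rotated])
      then show False by simp
    qed
  qed
  moreover have "{i} \<notin> dual N W \<longleftrightarrow> N - {i} \<in> W" using i by (simp add: dual_def)
  moreover have "{i, j} \<in> dual N W \<longleftrightarrow> N - {i, j} \<notin> W" if "j \<in> N" for j
    using i that by (simp add: dual_def)
  ultimately show ?thesis unfolding semi_passer_def semi_vetoer_def by metis
qed

text \<open>Since \<open>dual\<close> is an involution respecting isomorphism, \<open>AB\<close>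
  applied to \<open>dual N W\<close> also yields a preimage for each \<open>W\<close> in
  \<open>B\<close>.\<close>

lemma card_dual:
  assumes A: "A \<subseteq> {W. simple_game N W}" and B: "B \<subseteq> {W. simple_game N W}"
    and AB: "\<And>W. simple_game N W \<Longrightarrow> dual N W \<in> B \<longleftrightarrow> W \<in> A"
  shows "card (A // game_iso N) = card (B // game_iso N)"
proof (rule card_quotient_eq[where f = "dual N", OF equiv_game_iso equiv_game_iso A B])
  show "dual N W \<in> B" if "W \<in> A" for W using that A AB by blast
  show "(W, W') \<in> game_iso N \<longleftrightarrow> (dual N W, dual N W') \<in> game_iso N"
    if "W \<in> A" "W' \<in> A" for W W'
    using that A iso_dual dual_dual unfolding game_iso_iff by (metis mem_Collect_eq subsetD)
  fix W assume "W \<in> B"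
  then have W: "simple_game N W" using B by blast
  then have "dual N W \<in> A" using \<open>W \<in> B\<close> AB[OF simple_dual[OF W]] dual_dual[OF W] by simp
  moreover have "(dual N (dual N W), W) \<in> game_iso N"
    using dual_dual[OF W] iso_by_id[OF W] game_iso_iff by metis
  ultimately show "\<exists>W' \<in> A. (dual N W', W) \<in> game_iso N" by blast
qed

section \<open>Comparison of the four families\<close>

lemma CG_subset: "CG n t \<subseteq> {W. simple_game {1..n} W}"
  by (auto simp: CG_def complete_game_def)

lemma dual_mem_CG: "simple_game {1..n} W \<Longrightarrow> dual {1..n} W \<in> CG n t \<longleftrightarrow> W \<in> CG n t"
  by (simp add: CG_def complete_dual num_types_dual)

lemma card_CGVN_CGVSV: "card (CGVN n t) = card (CGVSV n t)"
proof -
  have *: "{W \<in> CG n t. (\<exists>i \<in> {1..n}. vetoer W i) \<and> (\<exists>i \<in> {1..n}. Q {1..n} W i)} =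
      veto_games_with Q {1..n} t" for Q
    by (simp add: veto_games_with_def veto_games_def CG_def conj_assoc)
  show ?thesis
    unfolding CGVN_def CGVSV_def using *[of "\<lambda>N. null_player"] *[of semi_vetoer]
      card_veto_null_eq_semi[of "{1..n}" t] by simp
qed

lemma card_CGVSV_CGPSP: "card (CGVSV n t) = card (CGPSP n t)"
  unfolding CGVSV_def CGPSP_def
proof (rule card_dual)
  fix W assume W: "simple_game {1..n} W"
  show "dual {1..n} W \<in> {W \<in> CG n t. (\<exists>i \<in> {1..n}. passer W i) \<and> (\<exists>i \<in> {1..n}. semi_passer {1..n} W i)}
      \<longleftrightarrow> W \<in> {W \<in> CG n t. (\<exists>i \<in> {1..n}. vetoer W i) \<and> (\<exists>i \<in> {1..n}. semi_vetoer {1..n} W i)}"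
    unfolding mem_Collect_eq using passer_dual[OF W] semi_passer_dual[OF W] dual_mem_CG[OF W] by metis
qed (use CG_subset in blast)+

lemma card_CGVN_CGPN: "card (CGVN n t) = card (CGPN n t)"
  unfolding CGVN_def CGPN_def
proof (rule card_dual)
  fix W assume W: "simple_game {1..n} W"
  show "dual {1..n} W \<in> {W \<in> CG n t. (\<exists>i \<in> {1..n}. passer W i) \<and> (\<exists>i \<in> {1..n}. null_player W i)}
      \<longleftrightarrow> W \<in> {W \<in> CG n t. (\<exists>i \<in> {1..n}. vetoer W i) \<and> (\<exists>i \<in> {1..n}. null_player W i)}"
    unfolding mem_Collect_eq
    using passer_dual[OF W] null_player_dual[OF _ W] dual_mem_CG[OF W] by (metis finite_atLeastAtMost)
qed (use CG_subset in blast)+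

theorem theoremT:
  fixes n t :: nat
  assumes "n > 1" and "t > 1"
  shows "\<forall>X \<in> {CGVSV n t, CGPSP n t, CGVN n t, CGPN n t}.
         \<forall>Y \<in> {CGVSV n t, CGPSP n t, CGVN n t, CGPN n t}.
           \<exists>f. bij_betw f X Y"
proof (intro ballI)
  fix X Y
  assume X: "X \<in> {CGVSV n t, CGPSP n t, CGVN n t, CGPN n t}"
    and Y: "Y \<in> {CGVSV n t, CGPSP n t, CGVN n t, CGPN n t}"
  \<comment> \<open>Equal cardinalities yield a bijection only for finite sets, as
    \<open>card\<close> is 0 on infinite ones.\<close>
  have "finite (CG n t)" by (rule finite_subset[OF CG_subset finite_simple_games]) simp
  then have "finite (CGVSV n t)" "finite (CGPSP n t)" "finite (CGVN n t)" "finite (CGPN n t)"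
    by (simp_all add: CGVSV_def CGPSP_def CGVN_def CGPN_def finite_quotientI)
  then have "finite X" "finite Y" using X Y by auto
  moreover have "card X = card Y"
    using X Y card_CGVN_CGVSV[of n t] card_CGVSV_CGPSP[of n t] card_CGVN_CGPN[of n t] by auto
  ultimately show "\<exists>f. bij_betw f X Y" using finite_same_card_bij by blast
qed

end
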